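(* Let $k\ge 3$, $1\le \ell<k/2$ and $1\le d\le k-1$ be integers. For every $n$ with $(k-\ell)\mid n$ there exists an $n$-vertex $k$-graph $H_0$ with $$\delta_d(H_0)\ge \left(1-\left(1-\frac{1}{2(k-\ell)}\right)^{k-d}-o(1)\right)\binom{n}{k-d}$$ containing no Hamilton $\ell$-cycle, where $o(1)$ denotes a quantity depending only on $k,\ell,d,n$ that tends to $0$ as $n\to\infty$ (with $k,\ell,d$ fixed). In other words, $$h_d^\ell(k)\ge 1-\left(1-\frac{1}{2(k-\ell)}\right)^{k-d}.$$
   Context: A $k$-graph $H=(V,E)$ consists of a finite vertex set $V$ and a family $E$ of $k$-element subsets of $V$. For a $d$-set $S\subseteq V$, $\deg_H(S)$ is the number of $(k-d)$-sets $T\subseteq V$ with $T\cup S\in E$, and $\delta_d(H)$ is the minimum of $\deg_H(S)$ over all $d$-sets $S\subseteq V$. For $1\le \ell<k$, a $k$-graph is an $\ell$-cycle if there is a cyclic ordering of its vertices such that every edge consists of $k$ consecutive vertices and any two consecutive edges share exactly $\ell$ vertices (so an $\ell$-cycle on $n$ vertices has exactly $n/(k-\ell)$ edges, and every vertex is in an edge). A $k$-graph on $n$ vertices contains a Hamilton $\ell$-cycle if it contains an $\ell$-cycle as a spanning subhypergraph; this requires $(k-\ell)\mid n$. $h_d^\ell(k,n)$ is the smallest integer $h$ such that every $n$-vertex $k$-graph $H$ with $\delta_d(H)\ge h$ contains a Hamilton $\ell$-cycle, and $$h_d^\ell(k):=\limsup_{n\to\infty}\frac{h_d^\ell(k,n)}{\binom{n}{k-d}},$$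 where $n$ ranges over multiples of $k-\ell$. *)

theory Defs
  imports "HOL-Analysis.Analysis"
begin

text \<open>A hypergraph is given by its vertex set \<open>V\<close> and its edge set \<open>E\<close>.\<close>

definition kgraph :: "nat \<Rightarrow> 'a set \<Rightarrow> 'a set set \<Rightarrow> bool" where
  "kgraph k V E \<longleftrightarrow> finite V \<and> (\<forall>e\<in>E. e \<subseteq> V \<and> card e = k)"

definition kdeg :: "nat \<Rightarrow> 'a set \<Rightarrow> 'a set set \<Rightarrow> 'a set \<Rightarrow> nat" where
  "kdeg k V E S = card {T. T \<subseteq> V \<and> card T = k - card S \<and> T \<union> S \<in> E}"

text \<open>The minimum \<open>d\<close>-degree is meaningful only for \<open>d \<le> card V\<close>; otherwise the minimum is over
  the empty set and its value is an unspecified natural number.\<close>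

definition min_deg :: "nat \<Rightarrow> nat \<Rightarrow> 'a set \<Rightarrow> 'a set set \<Rightarrow> nat" where
  "min_deg d k V E = Min (kdeg k V E ` {S. S \<subseteq> V \<and> card S = d})"

text \<open>The \<open>k\<close> consecutive vertices starting at position \<open>s\<close> in the cyclic ordering
  \<open>v 0, \<dots>, v (n - 1)\<close>.\<close>

definition cyc_segment :: "(nat \<Rightarrow> 'a) \<Rightarrow> nat \<Rightarrow> nat \<Rightarrow> nat \<Rightarrow> 'a set" where
  "cyc_segment v n k s = (\<lambda>j. v ((s + j) mod n)) ` {..<k}"

text \<open>In an \<open>l\<close>-cycle the edges are listed in the cyclic order of their starting positions \<open>s i\<close>,
  and the successor of the last edge is the first one. The conditions on \<open>card E\<close> and \<open>\<Union>E\<close>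
  exclude degenerate configurations, such as two edges that meet in \<open>l\<close> vertices on one side only.
  The condition \<open>E \<noteq> {}\<close> excludes only the hypergraph without vertices.\<close>

definition ell_cycle :: "nat \<Rightarrow> nat \<Rightarrow> 'a set \<Rightarrow> 'a set set \<Rightarrow> bool" where
  "ell_cycle k l V E \<longleftrightarrow>
     kgraph k V E \<and> E \<noteq> {} \<and> \<Union>E = V \<and> card E * (k - l) = card V \<and>
     (\<exists>v s. bij_betw v {..<card V} V \<and>
        strict_mono_on {..<card E} s \<and> s ` {..<card E} \<subseteq> {..<card V} \<and>
        E = (\<lambda>i. cyc_segment v (card V) k (s i)) ` {..<card E} \<and>
        (\<forall>i<card E. card (cyc_segment v (card V) k (s i) \<inter>
                          cyc_segment v (card V) k (s ((i + 1) mod card E))) = l))"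

definition has_hamilton_cycle :: "nat \<Rightarrow> nat \<Rightarrow> 'a set \<Rightarrow> 'a set set \<Rightarrow> bool" where
  "has_hamilton_cycle k l V E \<longleftrightarrow> (\<exists>F\<subseteq>E. ell_cycle k l V F)"

text \<open>All notions are invariant under isomorphism, so vertices are taken to be natural numbers.
  Degrees are natural numbers and an edgeless \<open>k\<close>-graph has no Hamilton \<open>l\<close>-cycle, so the least
  integer threshold is the least natural number threshold (it exists whenever \<open>d \<le> n\<close>,
  since the minimum \<open>d\<close>-degree is then bounded).\<close>

definition ham_threshold :: "nat \<Rightarrow> nat \<Rightarrow> nat \<Rightarrow> nat \<Rightarrow> nat" where
  "ham_threshold d l k n =
     (LEAST h. \<forall>(V :: nat set) E. kgraph k V E \<and> card V = n \<and> h \<le> min_deg d k V E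
                 \<longrightarrow> has_hamilton_cycle k l V E)"

text \<open>The limit superior is over \<open>n = m * (k - l)\<close>, the multiples of \<open>k - l\<close>.\<close>

definition ham_density :: "nat \<Rightarrow> nat \<Rightarrow> nat \<Rightarrow> ereal" where
  "ham_density d l k =
     limsup (\<lambda>m. ereal (real (ham_threshold d l k (m * (k - l)))
                        / real ((m * (k - l)) choose (k - d))))"

end

theory Submission
  imports Defs
begin

text \<open>Fix a set \<open>A\<close> of fewer than \<open>n / (2 (k - l))\<close> vertices and take all \<open>k\<close>-sets that meet \<open>A\<close>.
  Consecutive edges of an \<open>l\<close>-cycle start at least \<open>k - l > k / 2\<close> positions apart, so that every
  vertex lies in at most two edges; hence \<open>A\<close> meets fewer than \<open>n / (k - l)\<close> of the
  edges of a Hamilton \<open>l\<close>-cycle, and some edge avoids \<open>A\<close>. A \<open>d\<close>-set \<open>S\<close> forms a non-edge only with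
  \<open>(k - d)\<close>-sets outside \<open>A \<union> S\<close>, which are asymptotically a fraction
  \<open>(1 - 1 / (2 (k - l)))\<^sup>k\<^sup>-\<^sup>d\<close> of all \<open>(k - d)\<close>-sets.\<close>

section \<open>Cyclic segments and the incidences of an l-cycle\<close>

lemma inj_on_cyc_positions:
  fixes w n k :: nat
  assumes inj: "inj_on v {..<n}" and kn: "k \<le> n"
  shows "inj_on (\<lambda>j. v ((w + j) mod n)) {..<k}"
proof (rule inj_onI)
  fix i j assume i: "i \<in> {..<k}" and j: "j \<in> {..<k}"
    and eq: "v ((w + i) mod n) = v ((w + j) mod n)"
  have "(w + i) mod n = (w + j) mod n"
    using inj eq i j kn by (auto simp: inj_on_def)
  then obtain p q where "w + i + n * p = w + j + n * q"
    by (auto simp: nat_mod_eq_iff)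
  then have "i + n * p = j + n * q" by simp
  then have "i mod n = j mod n" by (auto simp: nat_mod_eq_iff)
  then show "i = j" using i j kn by simp
qed

text \<open>If \<open>w\<close> lies \<open>g\<close> steps after \<open>u\<close> around the cycle,
  the first \<open>k - g\<close> vertices of the segment at \<open>w\<close> also belong to the
  segment at \<open>u\<close>, so \<open>k - g\<close> is at most \<open>l\<close>. Stating the
  distance as a congruence covers the step from the last edge back to the first.\<close>

lemma cyc_segment_gap:
  assumes inj: "inj_on v {..<n}" and kn: "k \<le> n"
    and card: "card (cyc_segment v n k u \<inter> cyc_segment v n k w) = l"
    and g: "(u + g) mod n = w mod n"
  shows "k - l \<le> g"
proof -
  let ?f = "\<lambda>j. v ((w + j) mod n)"
  have fin: "finite (cyc_segment v n k u \<inter> cyc_segment v n k w)"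
    by (simp add: cyc_segment_def)
  have "?f ` {..<k - g} \<subseteq> cyc_segment v n k u \<inter> cyc_segment v n k w"
  proof
    fix x assume "x \<in> ?f ` {..<k - g}"
    then obtain j where j: "j < k - g" and x: "x = v ((w + j) mod n)" by auto
    have "(w + j) mod n = (u + (g + j)) mod n"
      using g by (metis add.assoc mod_add_left_eq)
    then have "x \<in> cyc_segment v n k u" "x \<in> cyc_segment v n k w"
      using j x unfolding cyc_segment_def
      by (auto intro!: image_eqI[where x = "g + j"] image_eqI[where x = j])
    then show "x \<in> cyc_segment v n k u \<inter> cyc_segment v n k w" by simp
  qed
  then have "card (?f ` {..<k - g}) \<le> l" using card_mono[OF fin] card by simp
  moreover have "inj_on ?f {..<k - g}"
    by (rule inj_on_subset[OF inj_on_cyc_positions[OF inj kn]]) auto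
  ultimately show ?thesis by (simp add: card_image)
qed

text \<open>The offsets of \<open>x\<close> in the segments containing it inherit the cyclic
  separation \<open>g\<close> of the starts. Three such offsets would span at least
  \<open>2 * g \<ge> k\<close>, yet all lie below \<open>k\<close>.\<close>

lemma card_cyc_segments_containing_le_2:
  fixes s :: "nat \<Rightarrow> nat"
  assumes inj: "inj_on v {..<n}" and kn: "k \<le> n" and kg: "k \<le> 2 * g"
    and sn: "\<And>i. i < m \<Longrightarrow> s i < n"
    and low: "\<And>i j. i < j \<Longrightarrow> j < m \<Longrightarrow> s i + g \<le> s j"
    and high: "\<And>i j. i < j \<Longrightarrow> j < m \<Longrightarrow> s j + g \<le> s i + n"
  shows "card {i. i < m \<and> x \<in> cyc_segment v n k (s i)} \<le> 2"
proof (rule ccontr)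
  let ?I = "{i. i < m \<and> x \<in> cyc_segment v n k (s i)}"
  assume "\<not> card ?I \<le> 2"
  then have "3 \<le> card ?I" by simp
  then obtain J where J: "J \<subseteq> ?I" "card J = 3"
    by (meson obtain_subset_with_card_n)
  have "\<forall>i\<in>?I. \<exists>j<k. x = v ((s i + j) mod n)"
    by (auto simp: cyc_segment_def)
  then obtain f where f: "\<And>i. i \<in> ?I \<Longrightarrow> f i < k \<and> x = v ((s i + f i) mod n)"
    by metis
  \<comment> \<open>Both sums \<open>s i + f i\<close> and \<open>s j + f j\<close> are below
    \<open>2 * n\<close>, so reduction modulo \<open>n\<close> subtracts \<open>n\<close> at most
    once. If both or neither wrap around, \<open>low\<close> separates the offsets; if only the
    later segment wraps, \<open>high\<close> does; the earlier one wrapping alone would force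
    \<open>f i \<ge> n\<close>.\<close>
  have dist: "g + f i \<le> f j \<or> g + f j \<le> f i" if "i \<in> ?I" "j \<in> ?I" "i < j" for i j
  proof -
    have im: "i < m" and jm: "j < m" using that by auto
    have "n > 0" using sn[OF im] by simp
    then have "(s i + f i) mod n = (s j + f j) mod n"
      using f[OF that(1)] f[OF that(2)] inj by (auto simp: inj_on_def)
    moreover have red: "y mod n = (if y < n then y else y - n)" if "y < 2 * n" for y
      using that by (simp add: mod_if)
    ultimately have "(if s i + f i < n then s i + f i else s i + f i - n)
        = (if s j + f j < n then s j + f j else s j + f j - n)"
      using f[OF that(1)] f[OF that(2)] sn[OF im] sn[OF jm] kn by (simp add: red)
    then show ?thesis
      using low[OF that(3) jm] high[OF that(3) jm] f[OF that(1)] f[OF that(2)] kn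
      by (auto split: if_splits)
  qed
  have dist': "g + f i \<le> f j \<or> g + f j \<le> f i" if "i \<in> ?I" "j \<in> ?I" "i \<noteq> j" for i j
    using dist[of i j] dist[of j i] that by (meson linorder_neqE_nat)
  obtain a b c where abc: "J = {a, b, c}" "a \<noteq> b" "b \<noteq> c" "a \<noteq> c"
    using J(2) by (auto simp: card_3_iff)
  have I: "a \<in> ?I" "b \<in> ?I" "c \<in> ?I" using J(1) abc(1) by auto
  show False
    using dist'[OF I(1,2) abc(2)] dist'[OF I(2,3) abc(3)] dist'[OF I(1,3) abc(4)]
      f[OF I(1)] f[OF I(2)] f[OF I(3)] kg by linarith
qed

text \<open>Double counting of pairs (edge index, vertex of \<open>A\<close> in that edge): each
  index contributes at least one pair, each vertex at most two.\<close>

lemma ell_cycle_card_le_transversal: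
  assumes cyc: "ell_cycle k l V F" and kl: "2 * l < k"
    and A: "finite A" "\<And>e. e \<in> F \<Longrightarrow> e \<inter> A \<noteq> {}"
  shows "card F \<le> 2 * card A"
proof -
  define n m where "n = card V" and "m = card F"
  obtain v s where v: "bij_betw v {..<n} V" and s: "strict_mono_on {..<m} s"
    and sn: "s ` {..<m} \<subseteq> {..<n}"
    and F: "F = (\<lambda>i. cyc_segment v n k (s i)) ` {..<m}"
    and ov: "\<And>i. i < m \<Longrightarrow> card (cyc_segment v n k (s i) \<inter>
                        cyc_segment v n k (s ((i + 1) mod m))) = l"
    using cyc unfolding ell_cycle_def n_def m_def by blast
  have kg: "kgraph k V F" and "F \<noteq> {}"
    using cyc by (auto simp: ell_cycle_def)
  then obtain e where "e \<subseteq> V" "card e = k" by (auto simp: kgraph_def)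
  then have kn: "k \<le> n"
    using kg unfolding n_def kgraph_def by (metis card_mono)
  have inj: "inj_on v {..<n}" using v by (auto simp: bij_betw_def)
  have sless: "s i < n" if "i < m" for i using sn that by auto
  have smono: "s i \<le> s j" if "i \<le> j" "j < m" for i j
    using strict_mono_on_leD[OF s, of i j] that by auto
  have low: "s i + (k - l) \<le> s j" if "i < j" "j < m" for i j
  proof -
    have i: "s i < s (Suc i)" using strict_mono_onD[OF s, of i "Suc i"] that by auto
    have "k - l \<le> s (Suc i) - s i"
    proof (rule cyc_segment_gap[OF inj kn])
      show "card (cyc_segment v n k (s i) \<inter> cyc_segment v n k (s (Suc i))) = l"
        using ov[of i] that by simp
    qed (use i in simp)
    then show ?thesis using smono[of "Suc i" j] that i by simp
  qed
  \<comment> \<open>The overlap of the last edge with the first bounds the gap across the end of the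
    ordering, \<open>s 0 + n - s (m - 1)\<close>; monotonicity of \<open>s\<close> carries this to
    all pairs.\<close>
  have high: "s j + (k - l) \<le> s i + n" if "i < j" "j < m" for i j
  proof -
    have "k - l \<le> s 0 + n - s (m - 1)"
    proof (rule cyc_segment_gap[OF inj kn])
      show "card (cyc_segment v n k (s (m - 1)) \<inter> cyc_segment v n k (s 0)) = l"
        using ov[of "m - 1"] that by simp
      show "(s (m - 1) + (s 0 + n - s (m - 1))) mod n = s 0 mod n"
        using sless[of "m - 1"] that by simp
    qed
    moreover have "s 0 \<le> s i" "s j \<le> s (m - 1)" "s (m - 1) < n"
      using smono[of 0 i] smono[of j "m - 1"] sless[of "m - 1"] that by auto
    ultimately show ?thesis by linarith
  qed
  let ?R = "\<lambda>i x. x \<in> cyc_segment v n k (s i)"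
  have fin: "finite {x \<in> A. ?R i x}" for i using A(1) by simp
  have "m = (\<Sum>i<m. 1)" by simp
  also have "\<dots> \<le> (\<Sum>i<m. card {x \<in> A. ?R i x})"
  proof (rule sum_mono)
    fix i assume "i \<in> {..<m}"
    then have "cyc_segment v n k (s i) \<inter> A \<noteq> {}" using A(2) F by blast
    then have "{x \<in> A. ?R i x} \<noteq> {}" by auto
    then have "card {x \<in> A. ?R i x} \<noteq> 0" using fin by (metis card_0_eq)
    then show "1 \<le> card {x \<in> A. ?R i x}" by linarith
  qed
  also have "\<dots> = (\<Sum>x\<in>A. card {i \<in> {..<m}. ?R i x})"
    by (rule sum_multicount_gen) (use A(1) in auto)
  also have "\<dots> \<le> (\<Sum>x\<in>A. 2)"
  proof (rule sum_mono)
    fix x assume "x \<in> A"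
    \<comment> \<open>Here \<open>2 * l < k\<close> enters: it makes the separation
      \<open>k - l\<close> at least half of \<open>k\<close>.\<close>
    show "card {i \<in> {..<m}. ?R i x} \<le> 2"
      using card_cyc_segments_containing_le_2[OF inj kn _ sless low high, where x = x] kl by simp
  qed
  finally show ?thesis by (simp add: m_def)
qed

section \<open>The k-graph of all k-sets meeting \<open>A\<close>, and its degrees\<close>

definition meeting_edges :: "nat \<Rightarrow> 'a set \<Rightarrow> 'a set \<Rightarrow> 'a set set" where
  "meeting_edges k V A = {e. e \<subseteq> V \<and> card e = k \<and> e \<inter> A \<noteq> {}}"

lemma kgraph_meeting_edges: "finite V \<Longrightarrow> kgraph k V (meeting_edges k V A)"
  by (auto simp: kgraph_def meeting_edges_def)

lemma meeting_edges_no_hamilton_cycle: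
  assumes "finite A" and kl: "2 * l < k" and A: "card V = 0 \<or> 2 * (k - l) * card A < card V"
  shows "\<not> has_hamilton_cycle k l V (meeting_edges k V A)"
proof
  assume "has_hamilton_cycle k l V (meeting_edges k V A)"
  then obtain F where F: "F \<subseteq> meeting_edges k V A" and cyc: "ell_cycle k l V F"
    by (auto simp: has_hamilton_cycle_def)
  have "card F \<le> 2 * card A"
    using ell_cycle_card_le_transversal[OF cyc kl \<open>finite A\<close>] F
    by (auto simp: meeting_edges_def)
  then have "card F * (k - l) \<le> 2 * (k - l) * card A"
    using mult_le_mono1[of "card F" "2 * card A" "k - l"] by (simp add: mult.commute mult.left_commute)
  moreover have V: "card V = card F * (k - l)" and "finite V" "F \<noteq> {}" "F \<subseteq> Pow V"
    using cyc by (auto simp: ell_cycle_def kgraph_def)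
  moreover from this have "card F > 0"
    by (metis card_gt_0_iff finite_Pow_iff finite_subset)
  \<comment> \<open>The edge count gives \<open>0 < card V \<le> 2 * (k - l) * card A\<close>, which
    refutes both alternatives in \<open>A\<close>.\<close>
  ultimately show False using A kl by auto
qed

text \<open>If \<open>S\<close> misses \<open>A\<close>, the sets \<open>T\<close> disjoint from
  \<open>S\<close> that fail are those inside \<open>V - S - A\<close>, whence the subtracted
  binomial. If \<open>S\<close> meets \<open>A\<close>, none fail.\<close>

lemma kdeg_meeting_edges:
  assumes V: "finite V" and A: "A \<subseteq> V" and S: "S \<subseteq> V" "card S = d" and d: "d \<le> k"
  shows "((card V - d) choose (k - d)) - ((card V - card A - d) choose (k - d))
    \<le> kdeg k V (meeting_edges k V A) S"
proof -
  let ?r = "k - d"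
  have fS: "finite S" and fA: "finite A" using V A S finite_subset by auto
  show ?thesis
  proof (cases "S \<inter> A = {}")
    case True
    let ?X = "{T. T \<subseteq> V - S \<and> card T = ?r}" and ?Y = "{T. T \<subseteq> V - S - A \<and> card T = ?r}"
    have "?X - ?Y \<subseteq> {T. T \<subseteq> V \<and> card T = k - card S \<and> T \<union> S \<in> meeting_edges k V A}"
    proof
      fix T assume T: "T \<in> ?X - ?Y"
      then have "card (T \<union> S) = k"
        using V fS S d by (subst card_Un_disjoint) (auto intro: finite_subset)
      then show "T \<in> {T. T \<subseteq> V \<and> card T = k - card S \<and> T \<union> S \<in> meeting_edges k V A}"
        using T S by (auto simp: meeting_edges_def)
    qed
    then have "card (?X - ?Y) \<le> kdeg k V (meeting_edges k V A) S"
      unfolding kdeg_def using V by (intro card_mono) auto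
    moreover have "card ?X - card ?Y \<le> card (?X - ?Y)"
      using V by (intro diff_card_le_card_Diff) auto
    moreover have "card ?X = (card V - d) choose ?r"
      using V S fS by (simp add: n_subsets card_Diff_subset)
    moreover have "card (V - S - A) = card V - card A - d"
      using V S A fS fA True
      by (subst card_Diff_subset) (auto simp: card_Diff_subset)
    then have "card ?Y = (card V - card A - d) choose ?r"
      using V by (simp add: n_subsets)
    ultimately show ?thesis by simp
  next
    case False
    let ?X = "{T. T \<subseteq> V - S \<and> card T = ?r}"
    have "?X \<subseteq> {T. T \<subseteq> V \<and> card T = k - card S \<and> T \<union> S \<in> meeting_edges k V A}"
    proof
      fix T assume T: "T \<in> ?X"
      then have "card (T \<union> S) = k"
        using V fS S d by (subst card_Un_disjoint) (auto intro: finite_subset)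
      then show "T \<in> {T. T \<subseteq> V \<and> card T = k - card S \<and> T \<union> S \<in> meeting_edges k V A}"
        using T S False by (auto simp: meeting_edges_def)
    qed
    then have "card ?X \<le> kdeg k V (meeting_edges k V A) S"
      unfolding kdeg_def using V by (intro card_mono) auto
    moreover have "card ?X = (card V - d) choose ?r"
      using V S fS by (simp add: n_subsets card_Diff_subset)
    ultimately show ?thesis by linarith
  qed
qed

section \<open>Minimum degree and the Hamilton threshold\<close>

lemma min_deg_attained:
  assumes "finite V" and "d \<le> card V"
  shows "\<exists>S \<subseteq> V. card S = d \<and> min_deg d k V E = kdeg k V E S"
proof -
  let ?D = "{S. S \<subseteq> V \<and> card S = d}"
  have "finite ?D" using assms(1) by simp
  moreover have "?D \<noteq> {}" using assms by (metis (mono_tags) Collect_empty_eq obtain_subset_with_card_n)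
  ultimately have "min_deg d k V E \<in> kdeg k V E ` ?D"
    unfolding min_deg_def by (intro Min_in) auto
  then show ?thesis by auto
qed

lemma min_deg_less_ham_threshold:
  fixes V :: "nat set"
  assumes G: "kgraph k V E" and d: "d \<le> card V" and no: "\<not> has_hamilton_cycle k l V E"
  shows "min_deg d k V E < ham_threshold d l k (card V)"
proof -
  let ?P = "\<lambda>h. \<forall>(W :: nat set) E. kgraph k W E \<and> card W = card V \<and> h \<le> min_deg d k W E
                 \<longrightarrow> has_hamilton_cycle k l W E"
  have bound: "min_deg d k W E' \<le> 2 ^ card V" if W': "kgraph k W E'" "card W = card V"
    for W :: "nat set" and E'
  proof -
    have W: "finite W" using W'(1) by (simp add: kgraph_def)
    obtain S where "min_deg d k W E' = kdeg k W E' S"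
      using min_deg_attained[OF W, of d] d W'(2) by metis
    also have "\<dots> \<le> card (Pow W)"
      unfolding kdeg_def using W by (intro card_mono) auto
    finally show ?thesis using W W'(2) by (simp add: card_Pow)
  qed
  \<comment> \<open>No minimum degree reaches this value, so the threshold property holds vacuously.
    This witness makes the \<open>LEAST\<close> in the threshold well defined.\<close>
  have "?P (Suc (2 ^ card V))"
    using bound by (metis not_less_eq_eq)
  then have "?P (ham_threshold d l k (card V))"
    unfolding ham_threshold_def by (rule LeastI)
  then show ?thesis using G no by (metis not_le)
qed

section \<open>Limits of binomial ratios\<close>

lemma binomial_ratio_tendsto:
  fixes x :: "nat \<Rightarrow> nat"
  assumes x: "(\<lambda>n. real (x n) / real n) \<longlonglongrightarrow> c"
  shows "(\<lambda>n. real (x n choose r) / real (n choose r)) \<longlonglongrightarrow> c ^ r"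
proof -
  \<comment> \<open>The factor \<open>r!\<close> cancels. For \<open>n < r\<close> both sides are 0,
    since division by zero yields 0.\<close>
  have eq: "real (x n choose r) / real (n choose r)
      = (\<Prod>i = 0..<r. (real (x n) - real i) / (real n - real i))" for n
    by (simp add: binomial_gbinomial gbinomial_prod_rev prod_dividef)
  have "(\<lambda>n. (real (x n) - real i) / (real n - real i)) \<longlonglongrightarrow> c" for i
  proof -
    have i: "(\<lambda>n. real i / real n) \<longlonglongrightarrow> 0" by (rule lim_const_over_n)
    have "(\<lambda>n. (real (x n) / real n - real i / real n) / (1 - real i / real n)) \<longlonglongrightarrow> (c - 0) / (1 - 0)"
      by (intro tendsto_intros x i) simp
    then have "(\<lambda>n. (real (x n) / real n - real i / real n) / (1 - real i / real n)) \<longlonglongrightarrow> c"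
      by simp
    then show ?thesis
    proof (rule Lim_transform_eventually)
      show "\<forall>\<^sub>F n in sequentially. (real (x n) / real n - real i / real n) / (1 - real i / real n)
          = (real (x n) - real i) / (real n - real i)"
        using eventually_gt_at_top[of i]
        by eventually_elim (simp add: field_simps)
    qed
  qed
  then have "(\<lambda>n. \<Prod>i = 0..<r. (real (x n) - real i) / (real n - real i)) \<longlonglongrightarrow> (\<Prod>i = 0..<r. c)"
    by (intro tendsto_prod)
  then show ?thesis by (simp add: eq)
qed

lemma nat_div_ratio_tendsto:
  fixes q :: nat
  assumes "q > 0"
  shows "(\<lambda>n. real ((n - 1) div q) / real n) \<longlonglongrightarrow> 1 / real q"
proof (rule tendsto_sandwich)
  have "(\<lambda>n. 1 / real q - 1 / real n) \<longlonglongrightarrow> 1 / real q - 0"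
    by (intro tendsto_intros lim_const_over_n)
  then show "(\<lambda>n. 1 / real q - 1 / real n) \<longlonglongrightarrow> 1 / real q" by simp
  show "\<forall>\<^sub>F n in sequentially. 1 / real q - 1 / real n \<le> real ((n - 1) div q) / real n"
    using eventually_gt_at_top[of 0]
  proof eventually_elim
    case (elim n)
    \<comment> \<open>The remainder is below \<open>q\<close>, so the quotient is at least
      \<open>n / q - 1\<close>; this gives the lower bound after division by
      \<open>n\<close>.\<close>
    have "n - 1 < q * ((n - 1) div q) + q"
      using assms by (metis add.commute dividend_less_times_div)
    then have "n \<le> q * ((n - 1) div q) + q" by simp
    then have "real n \<le> real q * real ((n - 1) div q) + real q"
      by (metis of_nat_add of_nat_le_iff of_nat_mult)
    then have "real n / (real q * real n) \<le> (real q * real ((n - 1) div q) + real q) / (real q * real n)"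
      by (intro divide_right_mono) auto
    then show ?case using elim assms by (simp add: add_divide_distrib)
  qed
  show "\<forall>\<^sub>F n in sequentially. real ((n - 1) div q) / real n \<le> 1 / real q"
    using eventually_gt_at_top[of 0]
  proof eventually_elim
    case (elim n)
    have "q * ((n - 1) div q) \<le> n"
      by (meson diff_le_self le_trans times_div_less_eq_dividend)
    then have "real q * real ((n - 1) div q) \<le> real n"
      by (metis of_nat_le_iff of_nat_mult)
    then show ?case using elim assms by (simp add: field_simps)
  qed
qed simp

section \<open>The size of \<open>A\<close>, the error term and the passage to the density\<close>

theorem proposition1p9:
  fixes k l d :: nat
  assumes "3 \<le> k" and "1 \<le> l" and "real l < real k / 2" and "1 \<le> d" and "d \<le> k - 1"
  shows "(\<exists>\<epsilon> :: nat \<Rightarrow> real. \<epsilon> \<longlonglongrightarrow> 0 \<and>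
           (\<forall>n. (k - l) dvd n \<longrightarrow>
             (\<exists>(V :: nat set) E. kgraph k V E \<and> card V = n \<and>
                real (min_deg d k V E)
                  \<ge> (1 - (1 - 1 / (2 * (real k - real l))) ^ (k - d) - \<epsilon> n)
                      * real (n choose (k - d)) \<and>
                \<not> has_hamilton_cycle k l V E))) \<and>
         ham_density d l k \<ge> ereal (1 - (1 - 1 / (2 * (real k - real l))) ^ (k - d))"
proof -
  have kl: "2 * l < k" using assms(3) by linarith
  have dk: "d \<le> k" using assms(5) by simp
  define r q where "r = k - d" and "q = 2 * (k - l)"
  have q: "q > 0" "real q = 2 * (real k - real l)" using kl by (auto simp: q_def of_nat_diff)
  define \<tau> where "\<tau> = 1 - (1 - 1 / real q) ^ r"
  \<comment> \<open>For \<open>n > 0\<close> this is the largest integer with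
    \<open>q * a n < n\<close>. At \<open>n = 0\<close> it is 0 and the strict inequality fails,
    hence the disjunction in \<open>an\<close>.\<close>
  define a where "a n = (n - 1) div q" for n :: nat
  have an: "n = 0 \<or> q * a n < n" for n
    using times_div_less_eq_dividend[of q "n - 1"] by (cases n) (auto simp: a_def less_Suc_eq_le)
  have al: "a n \<le> n" for n
    unfolding a_def by (meson div_le_dividend diff_le_self le_trans)
  define \<rho> where "\<rho> n = real ((n - d) choose r) / real (n choose r)
      - real ((n - a n - d) choose r) / real (n choose r)" for n
  \<comment> \<open>From \<open>n = k\<close> on, this is the exact gap between the target and the
    normalised degree bound \<open>\<rho> n\<close>. For \<open>n < k\<close> the value 1 makes the
    claimed bound nonpositive because \<open>\<tau> \<le> 1\<close>; there the minimum degree may be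
    unspecified.\<close>
  define \<epsilon> where "\<epsilon> n = (if n < k then 1 else \<tau> - \<rho> n)" for n
  define E where "E n = meeting_edges k {..<n} {..<a n}" for n

  have dn: "(\<lambda>n. real d / real n) \<longlonglongrightarrow> 0" by (rule lim_const_over_n)
  have r1: "(\<lambda>n. real (n - d) / real n) \<longlonglongrightarrow> 1"
  proof (rule Lim_transform_eventually)
    show "(\<lambda>n. 1 - real d / real n) \<longlonglongrightarrow> 1" using tendsto_diff[OF tendsto_const dn, of 1] by simp
    show "\<forall>\<^sub>F n in sequentially. 1 - real d / real n = real (n - d) / real n"
      using eventually_gt_at_top[of d]
      by eventually_elim (simp add: of_nat_diff field_simps)
  qed
  have lim: "(\<lambda>n. 1 - real (a n) / real n - real d / real n) \<longlonglongrightarrow> 1 - 1 / real q - 0"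
    unfolding a_def by (intro tendsto_diff tendsto_const nat_div_ratio_tendsto q(1) dn)
  have r2: "(\<lambda>n. real (n - a n - d) / real n) \<longlonglongrightarrow> 1 - 1 / real q"
  proof (rule Lim_transform_eventually)
    show "(\<lambda>n. 1 - real (a n) / real n - real d / real n) \<longlonglongrightarrow> 1 - 1 / real q"
      using lim by simp
    show "\<forall>\<^sub>F n in sequentially. 1 - real (a n) / real n - real d / real n = real (n - a n - d) / real n"
      using eventually_gt_at_top[of "2 * d"]
    proof eventually_elim
      case (elim n)
      \<comment> \<open>\<open>a n\<close> and \<open>d\<close> are each below \<open>n / 2\<close>,
        so the truncated subtraction agrees with the real one.\<close>
      have "2 * a n \<le> q * a n" using q(1) by (intro mult_le_mono1) (simp add: q_def)
      then have "a n + d \<le> n" using an[of n] elim by linarith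
      then show ?case using elim by (simp add: of_nat_diff field_simps)
    qed
  qed
  have "\<rho> \<longlonglongrightarrow> 1 ^ r - (1 - 1 / real q) ^ r"
    unfolding \<rho>_def by (intro tendsto_diff binomial_ratio_tendsto r1 r2)
  then have "(\<lambda>n. \<tau> - \<rho> n) \<longlonglongrightarrow> \<tau> - \<tau>"
    by (intro tendsto_diff tendsto_const) (simp add: \<tau>_def)
  then have "(\<lambda>n. \<tau> - \<rho> n) \<longlonglongrightarrow> 0" by simp
  then have \<epsilon>: "\<epsilon> \<longlonglongrightarrow> 0"
  proof (rule Lim_transform_eventually)
    show "\<forall>\<^sub>F n in sequentially. \<tau> - \<rho> n = \<epsilon> n"
      using eventually_ge_at_top[of k] by eventually_elim (simp add: \<epsilon>_def)
  qed

  have G: "kgraph k {..<n} (E n)" for n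
    unfolding E_def by (rule kgraph_meeting_edges) simp
  have noham: "\<not> has_hamilton_cycle k l {..<n} (E n)" for n
    unfolding E_def
    by (rule meeting_edges_no_hamilton_cycle[OF _ kl])
      (simp, use an[of n] in \<open>simp only: q_def card_lessThan\<close>)
  have deg: "real (min_deg d k {..<n} (E n)) \<ge> (\<tau> - \<epsilon> n) * real (n choose r)" for n
  proof (cases "n < k")
    case True
    have "1 / real q \<le> 1" using q(1) by simp
    then have "\<tau> \<le> 1" by (simp add: \<tau>_def)
    then have "(\<tau> - \<epsilon> n) * real (n choose r) \<le> 0"
      using True by (intro mult_nonpos_nonneg) (auto simp: \<epsilon>_def)
    then show ?thesis by linarith
  next
    case False
    obtain S where S: "S \<subseteq> {..<n}" "card S = d" "min_deg d k {..<n} (E n) = kdeg k {..<n} (E n) S"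
      using min_deg_attained[of "{..<n}" d k "E n"] dk False by auto
    have "((n - d) choose r) - ((n - a n - d) choose r) \<le> min_deg d k {..<n} (E n)"
      using kdeg_meeting_edges[of "{..<n}" "{..<a n}" S d k] S dk al[of n]
      by (simp add: E_def r_def)
    then have "real ((n - d) choose r) - real ((n - a n - d) choose r)
        \<le> real (min_deg d k {..<n} (E n))" by linarith
    moreover have "real (n choose r) \<noteq> 0" using False by (simp add: r_def)
    then have "\<rho> n * real (n choose r) = real ((n - d) choose r) - real ((n - a n - d) choose r)"
      by (simp add: \<rho>_def left_diff_distrib)
    ultimately show ?thesis using False by (simp add: \<epsilon>_def)
  qed

  have "ereal \<tau> \<le> ham_density d l k"
  proof -
    have sub: "filterlim (\<lambda>m. m * (k - l)) sequentially sequentially"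
      using kl by (intro filterlim_subseq strict_monoI) simp
    have "(\<lambda>m. \<tau> - \<epsilon> (m * (k - l))) \<longlonglongrightarrow> \<tau> - 0"
      by (intro tendsto_diff tendsto_const filterlim_compose[OF \<epsilon> sub])
    then have "(\<lambda>m. ereal (\<tau> - \<epsilon> (m * (k - l)))) \<longlonglongrightarrow> ereal \<tau>" by simp
    then have "ereal \<tau> = limsup (\<lambda>m. ereal (\<tau> - \<epsilon> (m * (k - l))))"
      by (intro lim_imp_Limsup[symmetric]) auto
    also have "\<dots> \<le> ham_density d l k"
      unfolding ham_density_def
    proof (rule Limsup_mono)
      \<comment> \<open>Once \<open>k\<close> is at most the number of vertices, d-sets exist and
        the binomial in the denominator is positive.\<close>
      have "\<forall>\<^sub>F m in sequentially. k \<le> m * (k - l)"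
        using sub by (simp add: filterlim_at_top)
      then show "\<forall>\<^sub>F m in sequentially. ereal (\<tau> - \<epsilon> (m * (k - l)))
          \<le> ereal (real (ham_threshold d l k (m * (k - l))) / real ((m * (k - l)) choose (k - d)))"
      proof eventually_elim
        case (elim m)
        let ?n = "m * (k - l)"
        have "min_deg d k {..<?n} (E ?n) < ham_threshold d l k ?n"
          using min_deg_less_ham_threshold[OF G _ noham, of d ?n] elim dk by simp
        then have "(\<tau> - \<epsilon> ?n) * real (?n choose r) \<le> real (ham_threshold d l k ?n)"
          using deg[of ?n] by linarith
        moreover have "?n choose r > 0" using elim by (simp add: r_def)
        ultimately show ?case by (simp add: r_def pos_le_divide_eq)
      qed
    qed
    finally show ?thesis .
  qed
  moreover have "\<exists>(V :: nat set) E. kgraph k V E \<and> card V = n \<and>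
      real (min_deg d k V E) \<ge> (\<tau> - \<epsilon> n) * real (n choose r) \<and> \<not> has_hamilton_cycle k l V E" for n
    using G[of n] deg[of n] noham[of n] by (intro exI[of _ "{..<n}"] exI[of _ "E n"]) simp
  ultimately show ?thesis
    using \<epsilon> unfolding \<tau>_def r_def q(2) by blast
qed

end
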